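(* Let $\mathbb{K}$ be an algebraically closed field of characteristic zero, let $S_1$ be a $\mathbb{K}$-vector space of dimension $3$, and let $d>0$ be an integer. Then for every form $f\in S_d=\operatorname{Sym}^d S_1$ (that is, every homogeneous polynomial of degree $d$ in three indeterminates over $\mathbb{K}$) we have \[ \operatorname{rk} f\le\left\lfloor\frac{d^2+6d+1}{4}\right\rfloor . \]
   Context: The (Waring) rank $\operatorname{rk} f$ of a form $f\in S_d$, $d>0$, is the least of the numbers $r$ such that $f$ can be written as a sum of $r$ $d$th powers of linear forms, i.e. $f=v_1^d+\cdots+v_r^d$ with $v_1,\ldots,v_r\in S_1$. *)

theory Defs
  imports
    Complex_Main
    "HOL-Library.Poly_Mapping"
    "HOL-Library.Extended_Nat"
    "HOL-Library.Cardinality"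
    "HOL-Computational_Algebra.Polynomial"
begin

text \<open>
  A polynomial with coefficients in \<open>'k\<close> and indeterminates indexed by \<open>'x\<close> is a finitely
  supported map from monomials \<open>'x \<Rightarrow>\<^sub>0 nat\<close> to \<open>'k\<close>; the ring structure (convolution product) is
  the one of \<^theory>\<open>HOL-Library.Poly_Mapping\<close>.
\<close>

type_synonym ('x, 'k) mpolynomial = "('x \<Rightarrow>\<^sub>0 nat) \<Rightarrow>\<^sub>0 'k"

definition monomial_degree :: "('x \<Rightarrow>\<^sub>0 nat) \<Rightarrow> nat" where
  "monomial_degree m = (\<Sum>i\<in>Poly_Mapping.keys m. Poly_Mapping.lookup m i)"

text \<open>
  The space \<open>S\<^sub>d\<close> of forms of degree \<open>d\<close>. It contains the zero polynomial, for every \<open>d\<close>.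
  \<open>forms 1\<close> is \<open>S\<^sub>1\<close>, with the indeterminates as a basis.
\<close>

definition forms :: "nat \<Rightarrow> ('x, 'k::zero) mpolynomial set" where
  "forms d = {f. \<forall>m\<in>Poly_Mapping.keys f. monomial_degree m = d}"

text \<open>
  The rank is an extended natural number, so that it is \<open>\<infinity>\<close> when \<open>f\<close> is not a sum of
  \<open>d\<close>-th powers of linear forms at all; in particular a finite upper bound on the rank includes
  the existence of a decomposition. The degree is an explicit argument because the zero
  polynomial is a form of every degree.
\<close>

definition waring_rank :: "nat \<Rightarrow> ('x, 'k::comm_semiring_1) mpolynomial \<Rightarrow> enat" where
  "waring_rank d f =
     Inf (enat ` {r. \<exists>v :: nat \<Rightarrow> ('x, 'k) mpolynomial.
                       (\<forall>i<r. v i \<in> forms 1) \<and> f = (\<Sum>i<r. v i ^ d)})"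

end

theory Submission
  imports Defs
begin

text \<open>
  Choose linear forms \<open>A, B, C\<close> such that \<open>f\<close> contains \<open>B\<^sup>d\<close>, and look for a decomposition into powers
  of forms \<open>A + x\<^sub>i B + w C\<close> with \<open>d + 1\<close> fixed values \<open>x\<^sub>i\<close>. Writing the coefficients of \<open>f\<close> as
  multinomial coefficients times \<open>F k m\<close>, this asks for sequences \<open>y k i\<close>, each of which is a sum
  \<open>\<Sum>\<^sub>s c\<^sub>s w\<^sub>s\<^sup>k\<close> of few geometric sequences in \<open>k\<close>, with \<open>\<Sum>\<^sub>i y k i x\<^sub>i\<^sup>m = F k m\<close> for \<open>k + m \<le> d\<close>.
  For given \<open>k\<close> these are \<open>d - k + 1\<close> Vandermonde equations, so \<open>k\<close> of the values \<open>y k i\<close> are free.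
  A sequence whose Hankel matrix of \<open>y 0 i, \<dots>, y (2n) i\<close> is invertible is, up to order \<open>2n\<close>, a sum of
  \<open>n + 1\<close> geometric sequences, and invertibility for \<open>n + 1\<close> excludes only one value of \<open>y (2n + 2) i\<close>.
  Thus the sequences can be fixed one after another with about \<open>i / 2 + 1\<close> terms for the \<open>i\<close>-th one,
  which gives about \<open>d\<^sup>2 / 4\<close> terms altogether. For even \<open>d\<close> the equation \<open>k = d\<close> is solved by one extra
  multiple of \<open>C\<^sup>d\<close>.
\<close>

section \<open>Simple roots, Lagrange interpolation and Vandermonde systems\<close>

text \<open>A simple root is not a root of its cofactor, and by the product rule the roots of the
  cofactor are again simple. So splitting off linear factors never meets a root twice.\<close>

lemma card_roots_eq_degree:
  fixes p :: "'a::alg_closed_field poly"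
  assumes "p \<noteq> 0" "\<And>a. poly p a = 0 \<Longrightarrow> poly (pderiv p) a \<noteq> 0"
  shows "card {a. poly p a = 0} = degree p"
  using assms
proof (induction "degree p" arbitrary: p)
  case 0
  then obtain c where "p = [:c:]" "c \<noteq> 0" by (metis degree_eq_zeroE pCons_0_0)
  then show ?case by simp
next
  case (Suc n)
  obtain a where a: "poly p a = 0"
    using alg_closed_imp_poly_has_root[of p] Suc.hyps(2) by auto
  then obtain q where p: "p = [:-a, 1:] * q" by (auto simp: poly_eq_0_iff_dvd)
  have q0: "q \<noteq> 0" using Suc.prems(1) p by auto
  have "degree p = degree [:-a, 1:] + degree q"
    unfolding p using q0 by (intro degree_mult_eq) auto
  then have deg: "degree q = n" using Suc.hyps(2) by simp
  have der: "poly (pderiv p) b = (b - a) * poly (pderiv q) b + poly q b" for b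
    unfolding p pderiv_mult by (simp add: pderiv_pCons algebra_simps)
  have qa: "poly q a \<noteq> 0" using Suc.prems(2)[OF a] der[of a] by simp
  have "poly (pderiv q) b \<noteq> 0" if "poly q b = 0" for b
    using Suc.prems(2)[of b] that der[of b] by (auto simp: p)
  then have "card {b. poly q b = 0} = n"
    using Suc.hyps(1)[of q] q0 deg by simp
  moreover have "{b. poly p b = 0} = insert a {b. poly q b = 0}" by (auto simp: p algebra_simps)
  ultimately show ?case using qa poly_roots_finite[OF q0] Suc.hyps(2) by simp
qed

lemma finite_card_image_lessThan:
  assumes "finite A" "card A = n"
  obtains w :: "nat \<Rightarrow> 'a" where "inj_on w {..<n}" "w ` {..<n} = A"
  using ex_bij_betw_nat_finite[OF assms(1)] assms(2)
  by (auto simp: bij_betw_def lessThan_atLeast0)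

text \<open>Both sides have degree below \<open>card S\<close> and agree at the nodes. The weights
  are obtained before \<open>p\<close>, since they depend on the nodes alone.\<close>

lemma lagrange_interpolation:
  fixes x :: "'i \<Rightarrow> 'a::field"
  assumes "finite S" "inj_on x S"
  obtains \<omega> where "\<And>i. i \<in> S \<Longrightarrow> \<omega> i \<noteq> 0"
    "\<And>p. degree p < card S \<Longrightarrow>
       p = (\<Sum>i\<in>S. smult (\<omega> i * poly p (x i)) (\<Prod>j\<in>S - {i}. [:- x j, 1:]))"
proof
  let ?\<omega> = "\<lambda>i. 1 / (\<Prod>j\<in>S - {i}. x i - x j)"
  show nz: "?\<omega> i \<noteq> 0" if "i \<in> S" for i
    using assms that by (auto simp: inj_on_def)
  show "p = (\<Sum>i\<in>S. smult (?\<omega> i * poly p (x i)) (\<Prod>j\<in>S - {i}. [:- x j, 1:]))"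
    (is "p = ?r") if "degree p < card S" for p
  proof (rule poly_eqI_degree[of "x ` S"])
    have card: "card (x ` S) = card S" using assms by (simp add: card_image)
    show "degree p < card (x ` S)" using that card by simp
    have "degree (smult c (\<Prod>j\<in>S - {i}. [:- x j, 1:])) \<le> card S - 1" if "i \<in> S" for i c
    proof -
      have "degree (\<Prod>j\<in>S - {i}. [:- x j, 1:]) \<le> (\<Sum>j\<in>S-{i}. 1)"
        using degree_prod_sum_le[of "S - {i}" "\<lambda>j. [:- x j, 1:]"] assms(1) by simp
      then show ?thesis using that assms(1) by (auto intro: order_trans[OF degree_smult_le])
    qed
    then have "degree ?r \<le> card S - 1" by (intro degree_sum_le assms)
    then show "degree ?r < card (x ` S)" using that card by simp
    fix a assume "a \<in> x ` S"
    then obtain l where l: "l \<in> S" "a = x l" by auto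
    have "poly ?r a = (\<Sum>i\<in>S. ?\<omega> i * poly p (x i) * (\<Prod>j\<in>S - {i}. x l - x j))"
      by (simp add: l poly_sum poly_prod)
    also have "\<dots> = (\<Sum>i\<in>S. if i = l then poly p (x l) else 0)"
    proof (rule sum.cong)
      fix i assume i: "i \<in> S"
      show "?\<omega> i * poly p (x i) * (\<Prod>j\<in>S - {i}. x l - x j) = (if i = l then poly p (x l) else 0)"
        using nz[OF l(1)] l(1) assms(1) by (auto intro!: prod_zero bexI[of _ l])
    qed simp
    finally show "poly p a = poly ?r a" using l assms(1) by simp
  qed
qed

lemma coeff_prod_linear_card:
  fixes x :: "'i \<Rightarrow> 'a::field"
  assumes "finite T"
  shows "coeff (\<Prod>j\<in>T. [:- x j, 1:]) (card T) = 1" "degree (\<Prod>j\<in>T. [:- x j, 1:]) = card T"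
proof -
  show "degree (\<Prod>j\<in>T. [:- x j, 1:]) = card T" by (subst degree_prod_eq_sum_degree) auto
  then show "coeff (\<Prod>j\<in>T. [:- x j, 1:]) (card T) = 1"
    using lead_coeff_prod[of "\<lambda>j. [:- x j, 1:]" T] by simp
qed

text \<open>Comparing the coefficients of \<open>X^n\<close> in Lagrange's formula for
  \<open>X^m\<close> inverts the Vandermonde matrix. The node polynomials are monic, so
  \<open>n = card S - 1\<close> makes \<open>\<omega>\<close> a kernel vector of all equations but
  the last, and it has no zero entry. The solution is stated explicitly because
  \<open>initial_moments\<close> needs its dependence on \<open>F\<close>.\<close>

lemma moment_weights:
  fixes x :: "'i \<Rightarrow> 'a::field"
  assumes "finite S" "inj_on x S"
  shows "\<exists>\<omega>. (\<forall>i\<in>S. \<omega> i \<noteq> 0) \<and> (\<forall>m. Suc m < card S \<longrightarrow> (\<Sum>i\<in>S. \<omega> i * x i ^ m) = 0) \<and>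
    (\<forall>m<card S. (\<Sum>i\<in>S.
       \<omega> i * (\<Sum>n<card S. coeff (\<Prod>j\<in>S - {i}. [:- x j, 1:]) n * F n) * x i ^ m) = F m)"
proof -
  obtain \<omega> where nz: "\<And>i. i \<in> S \<Longrightarrow> \<omega> i \<noteq> 0" and
    lag: "\<And>p. degree p < card S \<Longrightarrow>
       p = (\<Sum>i\<in>S. smult (\<omega> i * poly p (x i)) (\<Prod>j\<in>S - {i}. [:- x j, 1:]))"
    using lagrange_interpolation[OF assms] by blast
  have c: "(if m = n then 1 else 0) =
      (\<Sum>i\<in>S. \<omega> i * x i ^ m * coeff (\<Prod>j\<in>S - {i}. [:- x j, 1:]) n)" if "m < card S" for m n
    using arg_cong[OF lag[of "monom 1 m"], of "\<lambda>p. coeff p n"] that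
    by (simp add: degree_monom_eq poly_monom coeff_sum)
  have top: "coeff (\<Prod>j\<in>S - {i}. [:- x j, 1:]) (card S - 1) = 1" if "i \<in> S" for i
    using coeff_prod_linear_card(1)[of "S - {i}" x] that assms(1) by simp
  have vanish: "(\<Sum>i\<in>S. \<omega> i * x i ^ m) = 0" if m: "Suc m < card S" for m
    using c[of m "card S - 1"] m top by (simp split: if_splits)
  have solve: "(\<Sum>i\<in>S.
       \<omega> i * (\<Sum>n<card S. coeff (\<Prod>j\<in>S - {i}. [:- x j, 1:]) n * F n) * x i ^ m) = F m"
    if m: "m < card S" for m
  proof -
    have "(\<Sum>i\<in>S. \<omega> i * (\<Sum>n<card S. coeff (\<Prod>j\<in>S - {i}. [:- x j, 1:]) n * F n) * x i ^ m)
        = (\<Sum>i\<in>S. \<Sum>n<card S. \<omega> i * x i ^ m * coeff (\<Prod>j\<in>S - {i}. [:- x j, 1:]) n * F n)"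
      by (simp add: sum_distrib_left sum_distrib_right mult_ac)
    also have "\<dots> = (\<Sum>n<card S. (\<Sum>i\<in>S. \<omega> i * x i ^ m * coeff (\<Prod>j\<in>S - {i}. [:- x j, 1:]) n) * F n)"
      by (subst sum.swap) (simp add: sum_distrib_right)
    also have "\<dots> = (\<Sum>n<card S. (if m = n then 1 else 0) * F n)" using c[OF m] by simp
    also have "\<dots> = F m" using m by (simp add: if_distrib[of "\<lambda>u. u * _"] cong: if_cong)
    finally show ?thesis .
  qed
  show ?thesis by (rule exI[of _ \<omega>]) (simp add: nz vanish solve)
qed

lemma moments_solvable:
  fixes x :: "'i \<Rightarrow> 'a::field"
  assumes "finite S" "inj_on x S"
  obtains y where "\<And>m. m < card S \<Longrightarrow> (\<Sum>i\<in>S. y i * x i ^ m) = F m"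
proof -
  have "\<exists>y. \<forall>m<card S. (\<Sum>i\<in>S. y i * x i ^ m) = F m"
    using moment_weights[OF assms, of F] by (elim exE conjE) (rule exI)
  then show thesis using that by blast
qed

section \<open>Moment functionals, Hankel matrices and Gauss quadrature\<close>

text \<open>The linear functional that sends \<open>X^k\<close> to \<open>z k\<close>. Applied to
  the shifted sequence \<open>\<lambda>k. z (k + a)\<close>, it multiplies row \<open>a\<close> of
  the Hankel matrix by the coefficient vector.\<close>

definition mom :: "(nat \<Rightarrow> 'a::comm_ring_1) \<Rightarrow> 'a poly \<Rightarrow> 'a" where
  "mom z p = (\<Sum>k\<le>degree p. coeff p k * z k)"

lemma mom_eq: "degree p \<le> N \<Longrightarrow> mom z p = (\<Sum>k\<le>N. coeff p k * z k)"
  unfolding mom_def by (intro sum.mono_neutral_left) (auto simp: coeff_eq_0)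

lemma mom_add: "mom z (p + q) = mom z p + mom z q"
proof -
  let ?N = "max (degree p) (degree q)"
  show ?thesis
    using mom_eq[of p ?N z] mom_eq[of q ?N z] mom_eq[of "p + q" ?N z]
    by (simp add: degree_add_le_max sum.distrib algebra_simps)
qed

lemma mom_smult: "mom z (smult c p) = c * mom z p"
  using mom_eq[of "smult c p" "degree p" z]
  by (simp add: mom_def degree_smult_le sum_distrib_left mult_ac)

lemma mom_diff: "mom z (p - q) = mom z p - mom z q"
  using mom_add[of z "p - q" q] by simp

lemma mom_pCons: "mom z (pCons a p) = a * z 0 + mom (\<lambda>k. z (Suc k)) p"
proof -
  have "mom z (pCons a p) = (\<Sum>k\<le>Suc (degree p). coeff (pCons a p) k * z k)"
    by (rule mom_eq) (rule degree_pCons_le)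
  also have "\<dots> = coeff (pCons a p) 0 * z 0 + (\<Sum>k\<le>degree p. coeff (pCons a p) (Suc k) * z (Suc k))"
    by (rule sum.atMost_Suc_shift)
  finally show ?thesis by (simp add: mom_def[of _ p])
qed

lemma mom_monom: "mom z (monom 1 n) = z n"
  by (simp add: mom_eq[of _ n] degree_monom_le if_distrib[of "\<lambda>u. u * _"] cong: if_cong)

lemma mom_0 [simp]: "mom z 0 = 0" by (simp add: mom_def)

lemma mom_zero: "mom (\<lambda>k. 0) p = 0" by (simp add: mom_def)

text \<open>Shifting the sequence by \<open>a\<close> amounts to multiplying the argument by
  \<open>X^a\<close>. Hence vanishing shifted moments of \<open>p\<close> annihilate products
  \<open>p * q\<close> with \<open>q\<close> of low degree.\<close>

lemma mom_mult: "mom z (p * q) = mom (\<lambda>a. mom (\<lambda>k. z (k + a)) p) q"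
proof (induction q arbitrary: z)
  case (pCons c q)
  show ?case
    by (simp add: mom_pCons mom_add mom_smult pCons.IH)
qed simp

lemma mom_cong:
  assumes "\<And>k. k \<le> degree p \<Longrightarrow> z k = z' k"
  shows "mom z p = mom z' p"
  unfolding mom_def by (rule sum.cong) (simp_all add: assms)

lemma mom_power_sum:
  "mom (\<lambda>k. \<Sum>s<n. c s * w s ^ k) p = (\<Sum>s<n. c s * poly p (w s))"
proof -
  have "mom (\<lambda>k. \<Sum>s<n. c s * w s ^ k) p = (\<Sum>k\<le>degree p. \<Sum>s<n. c s * (coeff p k * w s ^ k))"
    unfolding mom_def sum_distrib_left by (intro sum.cong refl mult.left_commute)
  also have "\<dots> = (\<Sum>s<n. \<Sum>k\<le>degree p. c s * (coeff p k * w s ^ k))"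
    by (rule sum.swap)
  finally show ?thesis by (simp only: poly_altdef sum_distrib_left)
qed

text \<open>Invertibility of the Hankel matrix of \<open>z 0, \<dots>, z (2 * n)\<close>.\<close>
definition nondeg :: "(nat \<Rightarrow> 'a::field) \<Rightarrow> nat \<Rightarrow> bool" where
  "nondeg z n \<longleftrightarrow> (\<forall>b. \<exists>\<psi>. degree \<psi> \<le> n \<and> (\<forall>a\<le>n. mom (\<lambda>k. z (k + a)) \<psi> = b a))"

lemma nondeg_cong:
  assumes "\<And>k. k \<le> 2 * n \<Longrightarrow> z k = z' k" "nondeg z n"
  shows "nondeg z' n"
  unfolding nondeg_def
proof
  fix b
  obtain \<psi> where "degree \<psi> \<le> n" "\<forall>a\<le>n. mom (\<lambda>k. z (k + a)) \<psi> = b a"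
    using assms(2)[unfolded nondeg_def, rule_format, of b] by blast
  moreover have "mom (\<lambda>k. z (k + a)) \<psi> = mom (\<lambda>k. z' (k + a)) \<psi>" if "a \<le> n" for a
    using \<open>degree \<psi> \<le> n\<close> that by (intro mom_cong assms(1)) simp
  ultimately show "\<exists>\<psi>. degree \<psi> \<le> n \<and> (\<forall>a\<le>n. mom (\<lambda>k. z' (k + a)) \<psi> = b a)"
    by auto
qed

lemma nondeg_0: "z 0 \<noteq> 0 \<Longrightarrow> nondeg z 0"
  unfolding nondeg_def by (intro allI exI[of _ "[:_ 0 / z 0:]"]) (simp add: mom_pCons)

text \<open>The Hankel system is solved for the lower coefficients, with the moments of
  \<open>- X^(n+1)\<close> as the right-hand side.\<close>

lemma monic_orthogonal:
  assumes "nondeg z n"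
  obtains \<phi> where "degree \<phi> = Suc n" "coeff \<phi> (Suc n) = 1"
    "\<And>a. a \<le> n \<Longrightarrow> mom (\<lambda>k. z (k + a)) \<phi> = 0"
proof -
  obtain \<psi> where \<psi>: "degree \<psi> \<le> n" "\<And>a. a \<le> n \<Longrightarrow> mom (\<lambda>k. z (k + a)) \<psi> = - z (Suc n + a)"
    using assms[unfolded nondeg_def, rule_format, of "\<lambda>a. - z (Suc n + a)"] by blast
  have "degree (monom 1 (Suc n) + \<psi>) = Suc n"
    using \<psi>(1) by (subst degree_add_eq_left) (auto simp: degree_monom_eq)
  moreover have "coeff (monom 1 (Suc n) + \<psi>) (Suc n) = 1"
    using \<psi>(1) by (simp add: coeff_eq_0)
  moreover have "mom (\<lambda>k. z (k + a)) (monom 1 (Suc n) + \<psi>) = 0" if "a \<le> n" for a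
    using \<psi>(2)[OF that] by (simp add: mom_add mom_monom)
  ultimately show thesis using that by blast
qed

lemma mom_update_top:
  assumes "degree \<phi> \<le> N" "coeff \<phi> N = 1" "\<And>k. k < N \<Longrightarrow> z' k = z k"
  shows "mom z' \<phi> = mom z \<phi> + (z' N - z N)"
proof -
  have "(\<Sum>k<N. coeff \<phi> k * z' k) = (\<Sum>k<N. coeff \<phi> k * z k)" using assms(3) by simp
  then show ?thesis
    using assms(2) mom_eq[OF assms(1), of z] mom_eq[OF assms(1), of z']
    by (simp add: lessThan_Suc_atMost[symmetric])
qed

text \<open>The orthogonal polynomial \<open>\<phi>\<close> supplies the missing column: it
  contributes nothing to the old equations, so only its moment against \<open>X^(n+1)\<close> has to
  be non-zero. That moment contains \<open>z (2 * n + 2)\<close> with coefficient 1.\<close>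

lemma nondeg_Suc:
  assumes "nondeg z n"
  shows "\<exists>e. \<forall>z'. (\<forall>k\<le>2 * n + 1. z' k = z k) \<longrightarrow> z' (2 * n + 2) \<noteq> e \<longrightarrow> nondeg z' (Suc n)"
proof -
  obtain \<phi> where \<phi>: "degree \<phi> = Suc n" "coeff \<phi> (Suc n) = 1"
    "\<And>a. a \<le> n \<Longrightarrow> mom (\<lambda>k. z (k + a)) \<phi> = 0"
    using monic_orthogonal[OF assms] by blast
  \<comment> \<open>At this value of \<open>z' (2 * n + 2)\<close> the polynomial
    \<open>\<phi>\<close> would be orthogonal to \<open>X^(n+1)\<close> as well.\<close>
  define e where "e = z (2 * n + 2) - mom (\<lambda>k. z (k + Suc n)) \<phi>"
  have "nondeg z' (Suc n)" if z': "\<And>k. k \<le> 2 * n + 1 \<Longrightarrow> z' k = z k" and ne: "z' (2 * n + 2) \<noteq> e" for z'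
  proof -
    have 0: "mom (\<lambda>k. z' (k + a)) \<phi> = 0" if "a \<le> n" for a
      using \<phi>(3)[OF that] mom_cong[of \<phi> "\<lambda>k. z' (k + a)" "\<lambda>k. z (k + a)"] z' that \<phi>(1) by simp
    have top: "mom (\<lambda>k. z' (k + Suc n)) \<phi> \<noteq> 0"
    proof
      assume "mom (\<lambda>k. z' (k + Suc n)) \<phi> = 0"
      moreover have "mom (\<lambda>k. z' (k + Suc n)) \<phi>
          = mom (\<lambda>k. z (k + Suc n)) \<phi> + (z' (Suc n + Suc n) - z (Suc n + Suc n))"
        using \<phi>(1,2) z' by (intro mom_update_top) auto
      ultimately have "z' (Suc n + Suc n) = z (Suc n + Suc n) - mom (\<lambda>k. z (k + Suc n)) \<phi>"
        by (simp add: algebra_simps)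
      moreover have "Suc n + Suc n = 2 * n + 2" by simp
      ultimately show False using ne unfolding e_def by metis
    qed
    show ?thesis unfolding nondeg_def
    proof
      fix b
      have nd: "nondeg z' n" by (rule nondeg_cong[OF _ assms]) (simp add: z')
      obtain \<psi> where \<psi>: "degree \<psi> \<le> n" "\<And>a. a \<le> n \<Longrightarrow> mom (\<lambda>k. z' (k + a)) \<psi> = b a"
        using nd[unfolded nondeg_def, rule_format, of b] by blast
      define g where "g = (b (Suc n) - mom (\<lambda>k. z' (k + Suc n)) \<psi>) / mom (\<lambda>k. z' (k + Suc n)) \<phi>"
      have "mom (\<lambda>k. z' (k + a)) (\<psi> + smult g \<phi>) = b a" if "a \<le> Suc n" for a
        using that top 0 \<psi>(2) by (cases "a = Suc n") (auto simp: mom_add mom_smult g_def)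
      moreover have "degree (\<psi> + smult g \<phi>) \<le> Suc n"
        using \<psi>(1) \<phi>(1) by (intro degree_add_le order_trans[OF degree_smult_le]) auto
      ultimately show "\<exists>\<psi>. degree \<psi> \<le> Suc n \<and> (\<forall>a\<le>Suc n. mom (\<lambda>k. z' (k + a)) \<psi> = b a)"
        by blast
    qed
  qed
  then show ?thesis by (intro exI[of _ e]) blast
qed

text \<open>
  Gauss quadrature: \<open>P\<close> is orthogonal to all polynomials of degree at most \<open>n\<close>, so the rule with
  the roots of \<open>P\<close> as nodes that is exact up to degree \<open>n\<close> is exact up to degree \<open>2 * n + 1\<close>.
\<close>
lemma power_sum_quadrature:
  fixes z :: "nat \<Rightarrow> 'a::alg_closed_field"
  assumes P: "degree P = Suc n" and simple: "\<And>a. poly P a = 0 \<Longrightarrow> poly (pderiv P) a \<noteq> 0"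
    and orth: "\<And>a. a \<le> n \<Longrightarrow> mom (\<lambda>k. z (k + a)) P = 0"
  shows "\<exists>c w. \<forall>k\<le>2 * n + 1. z k = (\<Sum>s<Suc n. c s * w s ^ k)"
proof -
  have P0: "P \<noteq> 0" using P by auto
  obtain w where w: "inj_on w {..<Suc n}" "w ` {..<Suc n} = {a. poly P a = 0}"
    using finite_card_image_lessThan[OF poly_roots_finite[OF P0]]
      card_roots_eq_degree[OF P0 simple] P by metis
  obtain c where c: "\<And>m. m < Suc n \<Longrightarrow> (\<Sum>s<Suc n. c s * w s ^ m) = z m"
    using moments_solvable[of "{..<Suc n}" w z] w(1) by auto
  have "z k = (\<Sum>s<Suc n. c s * w s ^ k)" if k: "k \<le> 2 * n + 1" for k
  proof -
    \<comment> \<open>Since \<open>k \<le> 2 * n + 1\<close>, the quotient has degree at most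
      \<open>n\<close>, so \<open>P * q\<close> has moment zero. At the nodes, which are roots of
      \<open>P\<close>, the remainder \<open>r\<close> takes the values of
      \<open>X^k\<close>.\<close>
    define q r where "q = monom 1 k div P" and "r = monom 1 k mod P"
    have qr: "monom 1 k = P * q + r" by (simp add: q_def r_def)
    have r: "degree r \<le> n" using degree_mod_less[OF P0, of "monom 1 k"] P by (auto simp: r_def)
    have q: "degree q \<le> n"
    proof (cases "q = 0")
      case False
      have "degree (P * q) = Suc n + degree q" using P0 False P by (simp add: degree_mult_eq)
      moreover have "degree (P * q) \<le> max (degree (monom (1::'a) k)) (degree r)"
        using degree_diff_le_max[of "monom 1 k" r] qr by simp
      ultimately show ?thesis using k r degree_monom_le[of "1::'a" k] by linarith
    qed simp
    have "mom z (P * q) = mom (\<lambda>k. 0) q"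
      unfolding mom_mult using q by (intro mom_cong orth) simp
    then have "z k = mom z r" using mom_monom[of z k] by (simp add: qr mom_add mom_zero)
    also have "\<dots> = mom (\<lambda>k. \<Sum>s<Suc n. c s * w s ^ k) r"
      using r by (intro mom_cong c[symmetric]) simp
    also have "\<dots> = (\<Sum>s<Suc n. c s * poly r (w s))" by (rule mom_power_sum)
    also have "\<dots> = (\<Sum>s<Suc n. c s * w s ^ k)"
    proof (rule sum.cong)
      fix s assume "s \<in> {..<Suc n}"
      then have "poly P (w s) = 0" using w(2) by blast
      then have "poly r (w s) = poly (monom 1 k) (w s)" by (simp add: qr)
      then show "c s * poly r (w s) = c s * w s ^ k" by (simp add: poly_monom)
    qed simp
    finally show ?thesis .
  qed
  then show ?thesis by blast
qed

lemma lead_coeff_pderiv: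
  fixes p :: "'a::field_char_0 poly"
  shows "lead_coeff (pderiv p) = of_nat (degree p) * lead_coeff p"
proof (cases "degree p")
  case 0
  then show ?thesis by (simp add: pderiv_eq_0_iff)
next
  case (Suc n)
  then show ?thesis by (simp add: degree_pderiv coeff_pderiv)
qed

text \<open>
  Changing \<open>z (2 * n + 1)\<close> moves the orthogonal polynomial of degree \<open>n + 1\<close> in a pencil without
  base points, and only finitely many members of that pencil have a multiple root.
\<close>
lemma power_sum_extension:
  fixes z :: "nat \<Rightarrow> 'a::{alg_closed_field, field_char_0}"
  assumes "nondeg z n"
  shows "\<exists>E. finite E \<and> (\<forall>z'. (\<forall>k\<le>2 * n. z' k = z k) \<longrightarrow> z' (2 * n + 1) \<notin> E \<longrightarrow>
    (\<exists>c w. \<forall>k\<le>2 * n + 1. z' k = (\<Sum>s<Suc n. c s * w s ^ k)))"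
proof -
  obtain \<phi> where \<phi>: "degree \<phi> = Suc n" "coeff \<phi> (Suc n) = 1"
    "\<And>a. a \<le> n \<Longrightarrow> mom (\<lambda>k. z (k + a)) \<phi> = 0"
    using monic_orthogonal[OF assms] by blast
  obtain \<psi> where \<psi>: "degree \<psi> \<le> n"
    "\<And>a. a \<le> n \<Longrightarrow> mom (\<lambda>k. z (k + a)) \<psi> = (if a = n then 1 else 0)"
    using assms[unfolded nondeg_def, rule_format, of "\<lambda>a. if a = n then 1 else 0"] by blast
  have "\<psi> \<noteq> 0" using \<psi>(2)[of n] by auto
  have "\<phi> \<noteq> 0" using \<phi>(1) by auto
  \<comment> \<open>After removal of a common factor, \<open>\<phi> * B = \<psi> * A\<close> with
    \<open>A\<close> monic of degree \<open>n\<close>. Orthogonality of \<open>\<phi>\<close> makes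
    the moment of the left side 0, the choice of \<open>\<psi>\<close> makes that of the right side
    1.\<close>
  have coprime: "\<not> (poly \<phi> \<rho> = 0 \<and> poly \<psi> \<rho> = 0)" for \<rho>
  proof
    assume "poly \<phi> \<rho> = 0 \<and> poly \<psi> \<rho> = 0"
    then obtain A B where AB: "\<phi> = [:-\<rho>, 1:] * A" "\<psi> = [:-\<rho>, 1:] * B"
      by (auto simp: poly_eq_0_iff_dvd elim!: dvdE)
    have "A \<noteq> 0" "B \<noteq> 0" using AB \<open>\<phi> \<noteq> 0\<close> \<open>\<psi> \<noteq> 0\<close> by auto
    have "degree \<phi> = 1 + degree A" "degree \<psi> = 1 + degree B"
      unfolding AB using \<open>A \<noteq> 0\<close> \<open>B \<noteq> 0\<close> by (subst degree_mult_eq; simp)+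
    then have dA: "degree A = n" and dB: "degree B \<le> n" using \<phi>(1) \<psi>(1) by auto
    have "lead_coeff \<phi> = lead_coeff A" unfolding AB lead_coeff_mult by simp
    then have lA: "coeff A n = 1" using \<phi>(1,2) dA by simp
    have "mom z (\<phi> * B) = mom (\<lambda>k. 0) B"
      unfolding mom_mult using dB by (intro mom_cong \<phi>(3)) simp
    moreover have "mom z (\<psi> * A) = mom (\<lambda>a. if a = n then 1 else 0) A"
      unfolding mom_mult using dA by (intro mom_cong \<psi>(2)) simp
    moreover have "\<dots> = 1"
      using dA lA by (simp add: mom_def if_distrib[of "\<lambda>u. _ * u"] cong: if_cong)
    moreover have "\<phi> * B = \<psi> * A" unfolding AB by (simp only: mult_ac)
    ultimately show False by (simp add: mom_zero)
  qed
  \<comment> \<open>The Wronskian of the pencil vanishes at every multiple root of a member. It is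
    non-zero because equal leading coefficients would force \<open>degree \<psi> = n + 1\<close> in
    characteristic zero.\<close>
  define W where "W = \<phi> * pderiv \<psi> - pderiv \<phi> * \<psi>"
  have "W \<noteq> 0"
  proof
    assume "W = 0"
    then have "lead_coeff (\<phi> * pderiv \<psi>) = lead_coeff (pderiv \<phi> * \<psi>)" by (simp add: W_def)
    then have "of_nat (degree \<psi>) * lead_coeff \<psi> = of_nat (Suc n) * lead_coeff \<psi>"
      using \<phi>(1,2) by (simp add: lead_coeff_mult lead_coeff_pderiv)
    then have "of_nat (degree \<psi>) = (of_nat (Suc n) :: 'a)" using \<open>\<psi> \<noteq> 0\<close> by simp
    then have "degree \<psi> = Suc n" by (simp only: of_nat_eq_iff)
    then show False using \<psi>(1) by simp
  qed
  \<comment> \<open>A member with a multiple root at \<open>\<rho>\<close> has parameter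
    \<open>\<phi> / \<psi>\<close> at \<open>\<rho>\<close>. Where \<open>\<psi>\<close> vanishes
    the quotient is 0 by convention, which merely excludes one further value.\<close>
  define E where "E = (\<lambda>\<rho>. z (2 * n + 1) + poly \<phi> \<rho> / poly \<psi> \<rho>) ` {\<rho>. poly W \<rho> = 0}"
  have "\<exists>c w. \<forall>k\<le>2 * n + 1. z' k = (\<Sum>s<Suc n. c s * w s ^ k)"
    if z': "\<And>k. k \<le> 2 * n \<Longrightarrow> z' k = z k" and E: "z' (2 * n + 1) \<notin> E" for z'
  proof -
    define t where "t = z' (2 * n + 1) - z (2 * n + 1)"
    \<comment> \<open>Under \<open>z'\<close> the moment of \<open>\<phi>\<close> against
      \<open>X^n\<close> becomes \<open>t\<close> and that of \<open>\<psi>\<close> is 1, so this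
      combination is orthogonal for \<open>z'\<close>.\<close>
    define P where "P = \<phi> - smult t \<psi>"
    have idx: "Suc n + n = 2 * n + 1" by simp
    have a\<phi>: "mom (\<lambda>k. z' (k + a)) \<phi> = (if a = n then t else 0)" if a: "a \<le> n" for a
    proof (cases "a = n")
      case True
      have "mom (\<lambda>k. z' (k + n)) \<phi> = mom (\<lambda>k. z (k + n)) \<phi> + (z' (Suc n + n) - z (Suc n + n))"
        using \<phi>(1,2) z' by (intro mom_update_top) auto
      then show ?thesis using True \<phi>(3)[of n] unfolding t_def idx by simp
    next
      case False
      have "mom (\<lambda>k. z' (k + a)) \<phi> = mom (\<lambda>k. z (k + a)) \<phi>"
        using \<phi>(1) a False by (intro mom_cong z') simp
      then show ?thesis using False \<phi>(3)[OF a] by simp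
    qed
    have a\<psi>: "mom (\<lambda>k. z' (k + a)) \<psi> = (if a = n then 1 else 0)" if a: "a \<le> n" for a
      using mom_cong[of \<psi> "\<lambda>k. z' (k + a)" "\<lambda>k. z (k + a)"] z' a \<psi>(1) \<psi>(2)[OF a] by simp
    show ?thesis
    proof (rule power_sum_quadrature)
      show "degree P = Suc n"
        unfolding P_def diff_conv_add_uminus using \<phi>(1) \<psi>(1)
        by (subst degree_add_eq_left) (auto intro: le_less_trans[OF degree_smult_le])
      show "mom (\<lambda>k. z' (k + a)) P = 0" if "a \<le> n" for a
        using a\<phi>[OF that] a\<psi>[OF that] by (simp add: P_def mom_diff mom_smult)
      show "poly (pderiv P) \<rho> \<noteq> 0" if "poly P \<rho> = 0" for \<rho>
      proof
        assume "poly (pderiv P) \<rho> = 0"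
        then have 1: "poly \<phi> \<rho> = t * poly \<psi> \<rho>" "poly (pderiv \<phi>) \<rho> = t * poly (pderiv \<psi>) \<rho>"
          using that by (auto simp: P_def pderiv_diff pderiv_smult)
        then have "poly W \<rho> = 0" by (simp add: W_def)
        moreover have "poly \<psi> \<rho> \<noteq> 0" using coprime[of \<rho>] 1 by auto
        then have "z' (2 * n + 1) = z (2 * n + 1) + poly \<phi> \<rho> / poly \<psi> \<rho>" using 1 by (simp add: t_def)
        ultimately show False using E unfolding E_def by blast
      qed
    qed
  qed
  moreover have "finite E" using poly_roots_finite[OF \<open>W \<noteq> 0\<close>] by (simp add: E_def)
  ultimately show ?thesis by (intro exI[of _ E]) blast
qed

section \<open>Moment equations solved by short power sums\<close>

text \<open>The \<open>w s\<close> may coincide and the \<open>c s\<close> may vanish, so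
  \<open>r\<close> only bounds the number of geometric sequences.\<close>

definition power_sum_seq :: "nat \<Rightarrow> (nat \<Rightarrow> 'a::field) \<Rightarrow> bool" where
  "power_sum_seq r z \<longleftrightarrow> (\<exists>c w. \<forall>k. z k = (\<Sum>s<r. c s * w s ^ k))"

text \<open>Only the values up to \<open>2 * n\<close> are prescribed, so the value at
  \<open>2 * n + 1\<close> can be chosen outside the finite exceptional set.\<close>

lemma nondeg_power_sum_seq:
  fixes z :: "nat \<Rightarrow> 'a::{alg_closed_field, field_char_0}"
  assumes "nondeg z n"
  shows "\<exists>z'. power_sum_seq (Suc n) z' \<and> (\<forall>k\<le>2 * n. z' k = z k)"
proof -
  obtain E where E: "finite E"
    "\<forall>z'. (\<forall>k\<le>2 * n. z' k = z k) \<longrightarrow> z' (2 * n + 1) \<notin> E \<longrightarrow>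
       (\<exists>c w. \<forall>k\<le>2 * n + 1. z' k = (\<Sum>s<Suc n. c s * w s ^ k))"
    using power_sum_extension[OF assms] by blast
  obtain t where "t \<notin> E" using ex_new_if_finite[OF infinite_UNIV_char_0 E(1)] by blast
  then obtain c w where "\<forall>k\<le>2 * n + 1. (z(2 * n + 1 := t)) k = (\<Sum>s<Suc n. c s * w s ^ k)"
    using E(2)[rule_format, of "z(2 * n + 1 := t)"] by auto
  then have "(\<Sum>s<Suc n. c s * w s ^ k) = z k" if "k \<le> 2 * n" for k
    using that by (auto dest!: spec[of _ k])
  moreover have "power_sum_seq (Suc n) (\<lambda>k. \<Sum>s<Suc n. c s * w s ^ k)"
    unfolding power_sum_seq_def by blast
  ultimately show ?thesis by (intro exI[of _ "\<lambda>k. \<Sum>s<Suc n. c s * w s ^ k"]) blast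
qed

definition solves_moments :: "nat \<Rightarrow> (nat \<Rightarrow> 'a::field) \<Rightarrow> (nat \<Rightarrow> nat \<Rightarrow> 'a) \<Rightarrow> nat \<Rightarrow> (nat \<Rightarrow> 'a) \<Rightarrow> bool" where
  "solves_moments d x F k y \<longleftrightarrow> (\<forall>m. k + m \<le> d \<longrightarrow> (\<Sum>i\<le>d. y i * x i ^ m) = F k m)"

lemma solves_moments_cong:
  assumes "solves_moments d x F k y" "\<And>i. i \<le> d \<Longrightarrow> y' i = y i"
  shows "solves_moments d x F k y'"
proof -
  have "(\<Sum>i\<le>d. y' i * x i ^ m) = (\<Sum>i\<le>d. y i * x i ^ m)" for m
    by (rule sum.cong) (simp_all add: assms(2))
  then show ?thesis using assms(1) by (simp add: solves_moments_def)
qed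

text \<open>With the first \<open>l\<close> unknowns fixed, the remaining \<open>d + 1 - l\<close>
  nodes carry a square Vandermonde system.\<close>

lemma complete_moments:
  fixes x :: "nat \<Rightarrow> 'a::field"
  assumes "inj_on x {..d}"
  shows "\<exists>y. (\<forall>i<l. y i = g i) \<and> (\<forall>m. l + m \<le> d \<longrightarrow> (\<Sum>i\<le>d. y i * x i ^ m) = F m)"
proof -
  have "inj_on x {l..d}" using assms by (auto simp: inj_on_def)
  then obtain u where u: "\<And>m. m < card {l..d} \<Longrightarrow>
      (\<Sum>i\<in>{l..d}. u i * x i ^ m) = F m - (\<Sum>i<l. g i * x i ^ m)"
    using moments_solvable[of "{l..d}" x "\<lambda>m. F m - (\<Sum>i<l. g i * x i ^ m)"] by blast
  let ?y = "\<lambda>i. if i < l then g i else u i"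
  have "(\<Sum>i\<le>d. ?y i * x i ^ m) = F m" if m: "l + m \<le> d" for m
  proof -
    have "{..d} = {..<l} \<union> {l..d}" using m by auto
    then have "(\<Sum>i\<le>d. ?y i * x i ^ m) = (\<Sum>i<l. ?y i * x i ^ m) + (\<Sum>i\<in>{l..d}. ?y i * x i ^ m)"
      by (simp only:) (rule sum.union_disjoint; force)
    then show ?thesis using u[of m] m by simp
  qed
  then show ?thesis by (intro exI[of _ ?y]) simp
qed

text \<open>One equation fewer is imposed than there are unknowns left, so any multiple
  \<open>t\<close> of the kernel vector \<open>\<omega>\<close> may be added. As
  \<open>\<omega>\<close> has no zero entry, each forbidden value rules out a single
  \<open>t\<close>.\<close>

lemma complete_moments_avoiding:
  fixes x :: "nat \<Rightarrow> 'a::field_char_0"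
  assumes "inj_on x {..d}" "\<And>i. finite (B i)"
  shows "\<exists>y. (\<forall>i<l. y i = g i) \<and> solves_moments d x F (Suc l) y \<and> (\<forall>i. l \<le> i \<and> i \<le> d \<longrightarrow> y i \<notin> B i)"
proof -
  \<comment> \<open>The equation for \<open>m = d - l\<close> is outside the required range; the
    value of \<open>F\<close> there serves as an arbitrary right-hand side.\<close>
  obtain y where y: "\<forall>i<l. y i = g i" "\<forall>m. l + m \<le> d \<longrightarrow> (\<Sum>i\<le>d. y i * x i ^ m) = F (Suc l) m"
    using complete_moments[OF assms(1), of l g "F (Suc l)"] by blast
  have inj: "inj_on x {l..d}" using assms(1) by (auto simp: inj_on_def)
  obtain \<omega> where \<omega>: "\<forall>i\<in>{l..d}. \<omega> i \<noteq> 0"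
    "\<forall>m. Suc m < card {l..d} \<longrightarrow> (\<Sum>i\<in>{l..d}. \<omega> i * x i ^ m) = 0"
    using moment_weights[OF finite_atLeastAtMost inj, of "\<lambda>_. 0"] by blast
  have "finite (\<Union>i\<in>{l..d}. (\<lambda>b. (b - y i) / \<omega> i) ` B i)" using assms(2) by blast
  from ex_new_if_finite[OF infinite_UNIV_char_0 this]
  obtain t where t: "\<And>i b. \<lbrakk>i \<in> {l..d}; b \<in> B i\<rbrakk> \<Longrightarrow> t \<noteq> (b - y i) / \<omega> i" by blast
  let ?y = "\<lambda>i. y i + (if i \<in> {l..d} then t * \<omega> i else 0)"
  have "(\<Sum>i\<le>d. ?y i * x i ^ m) = F (Suc l) m" if m: "Suc l + m \<le> d" for m
  proof -
    have "(\<Sum>i\<le>d. ?y i * x i ^ m) =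
        (\<Sum>i\<le>d. y i * x i ^ m) + (\<Sum>i\<le>d. if i \<in> {l..d} then t * \<omega> i * x i ^ m else 0)"
      by (subst sum.distrib[symmetric]) (rule sum.cong; simp add: algebra_simps)
    also have "(\<Sum>i\<le>d. if i \<in> {l..d} then t * \<omega> i * x i ^ m else 0) = (\<Sum>i\<in>{l..d}. t * \<omega> i * x i ^ m)"
      by (rule sum.mono_neutral_cong_right) auto
    also have "\<dots> = t * (\<Sum>i\<in>{l..d}. \<omega> i * x i ^ m)" by (simp add: sum_distrib_left mult.assoc)
    also have "\<dots> = 0" using \<omega>(2)[rule_format, of m] m by simp
    finally show ?thesis using y(2)[rule_format, of m] m by simp
  qed
  moreover have "?y i \<notin> B i" if "l \<le> i" "i \<le> d" for i
  proof
    assume "?y i \<in> B i"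
    then have "t \<noteq> (?y i - y i) / \<omega> i" using t[of i "?y i"] that by auto
    then show False using \<omega>(1)[rule_format, of i] that by simp
  qed
  ultimately show ?thesis
    using y(1) by (intro exI[of _ ?y]) (auto simp: solves_moments_def)
qed

text \<open>
  In the step from \<open>q\<close> to \<open>q + 1\<close>, node \<open>2 * q\<close> is completed to a power sum with \<open>q + 1\<close> terms. The
  moments of order \<open>2 * q + 1\<close> are then completed without any choice; those of order \<open>2 * q + 2\<close> leave
  one parameter, chosen to keep the Hankel matrices at the remaining nodes invertible. Finally node
  \<open>2 * q + 1\<close> is completed with \<open>q + 2\<close> terms.
\<close>
lemma staged_moments:
  fixes x :: "nat \<Rightarrow> 'a::{alg_closed_field, field_char_0}"
  assumes inj: "inj_on x {..d}" and y0: "solves_moments d x F 0 y0" "\<And>i. i \<le> d \<Longrightarrow> y0 i \<noteq> 0"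
  shows "2 * q \<le> d \<Longrightarrow> \<exists>y. (\<forall>k\<le>2 * q. solves_moments d x F k (y k)) \<and>
    (\<forall>i<2 * q. power_sum_seq (Suc ((i + 1) div 2)) (\<lambda>k. y k i)) \<and>
    (\<forall>i. 2 * q \<le> i \<and> i \<le> d \<longrightarrow> nondeg (\<lambda>k. y k i) q)"
proof (induction q)
  case 0
  show ?case using y0 by (intro exI[of _ "\<lambda>k. y0"]) (auto intro!: nondeg_0)
next
  case (Suc q)
  obtain y where y: "\<And>k. k \<le> 2 * q \<Longrightarrow> solves_moments d x F k (y k)"
    "\<And>i. i < 2 * q \<Longrightarrow> power_sum_seq (Suc ((i + 1) div 2)) (\<lambda>k. y k i)"
    "\<And>i. \<lbrakk>2 * q \<le> i; i \<le> d\<rbrakk> \<Longrightarrow> nondeg (\<lambda>k. y k i) q"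
    using Suc by (auto)
  have "nondeg (\<lambda>k. y k (2 * q)) q" using y(3) Suc.prems by simp
  from nondeg_power_sum_seq[OF this]
  obtain z where z: "power_sum_seq (Suc q) z" "\<forall>k\<le>2 * q. z k = y k (2 * q)" by blast
  \<comment> \<open>This replaces the sequence at node \<open>2 * q\<close> by its completion, which
    prescribes its values at the orders \<open>2 * q + 1\<close> and
    \<open>2 * q + 2\<close>.\<close>
  define g where "g k i = (if i = 2 * q then z k else y k i)" for k i
  have g_low: "g k i = y k i" if "k \<le> 2 * q" for k i using z(2) that by (simp add: g_def)
  have g_seq: "power_sum_seq (Suc ((i + 1) div 2)) (\<lambda>k. g k i)" if "i < 2 * q + 1" for i
    using y(2)[of i] z(1) that by (cases "i = 2 * q") (auto simp: g_def)
  obtain u where u: "\<forall>i<2 * q + 1. u i = g (2 * q + 1) i"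
    "solves_moments d x F (2 * q + 1) u"
    using complete_moments[OF inj, of "2 * q + 1" "g (2 * q + 1)" "F (2 * q + 1)"]
    unfolding solves_moments_def by blast
  define h where "h k i = (if k \<le> 2 * q then y k i else u i)" for k i
  have "nondeg (\<lambda>k. h k i) q" if "2 * q \<le> i" "i \<le> d" for i
    by (rule nondeg_cong[OF _ y(3)[OF that]]) (simp add: h_def)
  then have "\<exists>e. \<forall>z'. (\<forall>k\<le>2 * q + 1. z' k = h k i) \<longrightarrow> z' (2 * q + 2) \<noteq> e \<longrightarrow> nondeg z' (Suc q)"
    if "2 * q \<le> i" "i \<le> d" for i
    using nondeg_Suc[of "\<lambda>k. h k i" q] that by blast
  then have "\<forall>i. \<exists>e. 2 * q \<le> i \<and> i \<le> d \<longrightarrow>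
      (\<forall>z'. (\<forall>k\<le>2 * q + 1. z' k = h k i) \<longrightarrow> z' (2 * q + 2) \<noteq> e \<longrightarrow> nondeg z' (Suc q))"
    by blast
  then obtain e where e: "\<forall>i. 2 * q \<le> i \<and> i \<le> d \<longrightarrow>
      (\<forall>z'. (\<forall>k\<le>2 * q + 1. z' k = h k i) \<longrightarrow> z' (2 * q + 2) \<noteq> e i \<longrightarrow> nondeg z' (Suc q))"
    by (elim choice[elim_format] exE)
  obtain v where v: "\<forall>i<2 * q + 1. v i = g (2 * q + 2) i"
    "solves_moments d x F (2 * q + 2) v" "\<forall>i. 2 * q + 1 \<le> i \<and> i \<le> d \<longrightarrow> v i \<noteq> e i"
    using complete_moments_avoiding[OF inj, of "\<lambda>i. {e i}" "2 * q + 1" "g (2 * q + 2)" F] by auto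
  define t where "t k i = (if k = 2 * q + 2 then v i else h k i)" for k i
  have t: "nondeg (\<lambda>k. t k i) (Suc q)" if "2 * q + 1 \<le> i" "i \<le> d" for i
    using e[rule_format, of i "\<lambda>k. t k i"] v(3)[rule_format, of i] that by (simp add: t_def)
  from nondeg_power_sum_seq[OF t[of "2 * q + 1"]] Suc.prems
  obtain z1 where z1: "power_sum_seq (Suc (Suc q)) z1" "\<forall>k\<le>2 * q + 2. z1 k = t k (2 * q + 1)" by auto
  \<comment> \<open>At the completed nodes \<open>g\<close> is kept for every \<open>k\<close>,
    since \<open>power_sum_seq\<close> concerns the entire sequence. Up to order
    \<open>2 * q + 2\<close> it agrees with \<open>t\<close>, because \<open>u\<close> and
    \<open>v\<close> were prescribed there.\<close>
  define y' where "y' k i = (if i = 2 * q + 1 then z1 k else if i < 2 * q + 1 then g k i else t k i)" for k i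
  have low: "y' k i = t k i" if "k \<le> 2 * q + 2" for k i
  proof (cases "i < 2 * q + 1")
    case True
    consider "k \<le> 2 * q" | "k = 2 * q + 1" | "k = 2 * q + 2" using \<open>k \<le> 2 * q + 2\<close> by linarith
    then show ?thesis
      using True u(1)[rule_format, OF True] v(1)[rule_format, OF True] g_low[of k i] by cases (simp_all add: y'_def t_def h_def)
  next
    case False
    then show ?thesis using z1(2) that by (simp add: y'_def)
  qed
  have "solves_moments d x F k (y' k)" if k: "k \<le> 2 * Suc q" for k
  proof -
    consider "k \<le> 2 * q" | "k = 2 * q + 1" | "k = 2 * q + 2" using k[unfolded mult_Suc_right] by linarith
    then have "solves_moments d x F k (t k)"
      using y(1)[of k] u(2) v(2) by cases (simp_all add: t_def[abs_def] h_def[abs_def])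
    then show ?thesis by (rule solves_moments_cong) (use low k in simp)
  qed
  moreover have "power_sum_seq (Suc ((i + 1) div 2)) (\<lambda>k. y' k i)" if "i < 2 * Suc q" for i
    using g_seq[of i] z1(1) that by (cases "i = 2 * q + 1") (auto simp: y'_def)
  moreover have "nondeg (\<lambda>k. y' k i) (Suc q)" if "2 * Suc q \<le> i" "i \<le> d" for i
    using that by (intro nondeg_cong[OF _ t]) (auto simp: low)
  ultimately show ?case by blast
qed

text \<open>
  At the last odd order the Hankel matrices need not be kept invertible any further, so the free
  parameter is spent on giving all remaining nodes only \<open>p + 1\<close> terms.
\<close>
lemma moments_by_power_sums:
  fixes x :: "nat \<Rightarrow> 'a::{alg_closed_field, field_char_0}"
  assumes inj: "inj_on x {..d}" and y0: "solves_moments d x F 0 y0" "\<And>i. i \<le> d \<Longrightarrow> y0 i \<noteq> 0"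
    and p: "2 * p + 1 \<le> d"
  shows "\<exists>y. (\<forall>k\<le>2 * p + 1. solves_moments d x F k (y k)) \<and>
    (\<forall>i\<le>d. power_sum_seq (if i < 2 * p then Suc ((i + 1) div 2) else Suc p) (\<lambda>k. y k i))"
proof -
  obtain y where y: "\<And>k. k \<le> 2 * p \<Longrightarrow> solves_moments d x F k (y k)"
    "\<And>i. i < 2 * p \<Longrightarrow> power_sum_seq (Suc ((i + 1) div 2)) (\<lambda>k. y k i)"
    "\<And>i. \<lbrakk>2 * p \<le> i; i \<le> d\<rbrakk> \<Longrightarrow> nondeg (\<lambda>k. y k i) p"
    using staged_moments[OF inj y0, of p] p by auto
  have "\<exists>E. finite E \<and> (2 * p \<le> i \<and> i \<le> d \<longrightarrow>
      (\<forall>z'. (\<forall>k\<le>2 * p. z' k = y k i) \<longrightarrow> z' (2 * p + 1) \<notin> E \<longrightarrow>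
        (\<exists>c w. \<forall>k\<le>2 * p + 1. z' k = (\<Sum>s<Suc p. c s * w s ^ k))))" for i
  proof (cases "2 * p \<le> i \<and> i \<le> d")
    case True
    then have "nondeg (\<lambda>k. y k i) p" using y(3) by blast
    from power_sum_extension[OF this] show ?thesis by blast
  qed blast
  then have "\<exists>E. \<forall>i. finite (E i) \<and> (2 * p \<le> i \<and> i \<le> d \<longrightarrow>
      (\<forall>z'. (\<forall>k\<le>2 * p. z' k = y k i) \<longrightarrow> z' (2 * p + 1) \<notin> E i \<longrightarrow>
        (\<exists>c w. \<forall>k\<le>2 * p + 1. z' k = (\<Sum>s<Suc p. c s * w s ^ k))))"
    by (intro choice allI)
  then obtain E where E: "\<forall>i. finite (E i) \<and> (2 * p \<le> i \<and> i \<le> d \<longrightarrow>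
      (\<forall>z'. (\<forall>k\<le>2 * p. z' k = y k i) \<longrightarrow> z' (2 * p + 1) \<notin> E i \<longrightarrow>
        (\<exists>c w. \<forall>k\<le>2 * p + 1. z' k = (\<Sum>s<Suc p. c s * w s ^ k))))"
    by (elim exE)
  have fin: "finite (E i)" for i using E by blast
  \<comment> \<open>Only the \<open>2 * p\<close> completed nodes are prescribed at order
    \<open>2 * p + 1\<close>; the remaining free parameter avoids all the sets \<open>E i\<close>
    simultaneously.\<close>
  obtain v where v: "\<forall>i<2 * p. v i = y (2 * p + 1) i"
    "solves_moments d x F (2 * p + 1) v" "\<forall>i. 2 * p \<le> i \<and> i \<le> d \<longrightarrow> v i \<notin> E i"
    using complete_moments_avoiding[of x d E "2 * p" "y (2 * p + 1)" F, OF inj fin] by auto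
  define t where "t k i = (if k \<le> 2 * p then y k i else v i)" for k i
  have "\<exists>z. power_sum_seq (Suc p) z \<and> (\<forall>k\<le>2 * p + 1. z k = t k i)" if i: "2 * p \<le> i" "i \<le> d" for i
  proof -
    obtain c w where cw: "\<forall>k\<le>2 * p + 1. t k i = (\<Sum>s<Suc p. c s * w s ^ k)"
      using E[THEN spec[of _ i], THEN conjunct2, rule_format, of "\<lambda>k. t k i"] i v(3)[rule_format, of i]
      by (auto simp: t_def)
    have "power_sum_seq (Suc p) (\<lambda>k. \<Sum>s<Suc p. c s * w s ^ k)"
      unfolding power_sum_seq_def by blast
    then show ?thesis using cw by (intro exI[of _ "\<lambda>k. \<Sum>s<Suc p. c s * w s ^ k"]) simp
  qed
  then have "\<forall>i. \<exists>z. 2 * p \<le> i \<and> i \<le> d \<longrightarrow> power_sum_seq (Suc p) z \<and> (\<forall>k\<le>2 * p + 1. z k = t k i)"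
    by blast
  from choice[OF this] obtain z where
    "\<forall>i. 2 * p \<le> i \<and> i \<le> d \<longrightarrow> power_sum_seq (Suc p) (z i) \<and> (\<forall>k\<le>2 * p + 1. z i k = t k i)"
    by (elim exE)
  then have z: "\<And>i. \<lbrakk>2 * p \<le> i; i \<le> d\<rbrakk> \<Longrightarrow> power_sum_seq (Suc p) (z i)"
    "\<And>i k. \<lbrakk>2 * p \<le> i; i \<le> d; k \<le> 2 * p + 1\<rbrakk> \<Longrightarrow> z i k = t k i"
    by blast+
  define y' where "y' k i = (if i < 2 * p then y k i else z i k)" for k i
  have low: "y' k i = t k i" if "k \<le> 2 * p + 1" "i \<le> d" for k i
  proof (cases "i < 2 * p")
    case True
    show ?thesis
      using True v(1)[rule_format, OF True] that by (cases "k = 2 * p + 1") (auto simp: y'_def t_def)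
  qed (use z(2)[of i k] that in \<open>simp add: y'_def\<close>)
  have "solves_moments d x F k (y' k)" if "k \<le> 2 * p + 1" for k
  proof -
    have "solves_moments d x F k (t k)"
      using y(1)[of k] v(2) that by (cases "k = 2 * p + 1") (auto simp: t_def[abs_def])
    then show ?thesis by (rule solves_moments_cong) (use low that in simp)
  qed
  moreover have "power_sum_seq (if i < 2 * p then Suc ((i + 1) div 2) else Suc p) (\<lambda>k. y' k i)"
    if "i \<le> d" for i
    using y(2)[of i] z(1)[of i] that by (auto simp: y'_def)
  ultimately show ?thesis by blast
qed

text \<open>The nodes \<open>2 * q\<close> and \<open>2 * q + 1\<close> with \<open>q < p\<close>
  contribute \<open>(q + 1) + (q + 2)\<close> terms, and the last two nodes contribute
  \<open>p + 1\<close> each.\<close>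

lemma node_count:
  "(\<Sum>i\<le>2 * p + 1. if i < 2 * p then Suc ((i + 1) div 2) else Suc p) = p\<^sup>2 + 4 * p + 2"
proof -
  have "(\<Sum>i<2 * p. Suc ((i + 1) div 2)) = p\<^sup>2 + 2 * p"
    by (induction p) (auto simp: power2_eq_square)
  then show ?thesis
    by (simp add: lessThan_Suc_atMost[symmetric])
qed

text \<open>The staged construction starts from Hankel matrices of size 1, which requires non-zero
  \<open>y i\<close>. For the nodes \<open>t * i\<close>, each \<open>y i\<close> is, up to a
  non-zero factor, a polynomial in \<open>t\<close> with constant term \<open>F d\<close>, so almost
  every \<open>t\<close> works.\<close>

lemma initial_moments:
  fixes F :: "nat \<Rightarrow> 'a::field_char_0"
  assumes "F d \<noteq> 0"
  shows "\<exists>t y. t \<noteq> 0 \<and> (\<forall>i\<le>d. y i \<noteq> 0) \<and> (\<forall>m\<le>d. (\<Sum>i\<le>d. y i * (t * of_nat i) ^ m) = F m)"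
proof -
  define e :: "nat \<Rightarrow> nat \<Rightarrow> 'a"
    where "e i n = coeff (\<Prod>j\<in>{..d} - {i}. [:- of_nat j, 1:]) n" for i n
  \<comment> \<open>This is the bracket in the explicit Vandermonde solution, multiplied by
    \<open>t ^ d\<close> to clear denominators.\<close>
  define q where "q i = (\<Sum>n\<le>d. monom (e i n * F n) (d - n))" for i
  have q: "poly (q i) t = (\<Sum>n\<le>d. e i n * F n * t ^ (d - n))" for i t
    by (simp add: q_def poly_sum poly_monom)
  have "poly (q i) 0 \<noteq> 0" if "i \<le> d" for i
  proof -
    have "e i d = 1"
      using coeff_prod_linear_card(1)[of "{..d} - {i}" "of_nat :: nat \<Rightarrow> 'a"] that by (simp add: e_def)
    moreover have "poly (q i) 0 = (\<Sum>n\<le>d. if n = d then e i n * F n else 0)"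
      unfolding q by (rule sum.cong) auto
    ultimately show ?thesis using assms by simp
  qed
  then have "q i \<noteq> 0" if "i \<le> d" for i using that by (metis poly_0)
  \<comment> \<open>The factor \<open>[:0, 1:]\<close> makes the chosen \<open>t\<close> non-zero,
    so that the nodes are distinct.\<close>
  then have "(\<Prod>i\<le>d. q i) * [:0, 1:] \<noteq> 0" by auto
  then obtain t where t: "poly ((\<Prod>i\<le>d. q i) * [:0, 1:]) t \<noteq> 0"
    using poly_all_0_iff_0 by blast
  then have t0: "t \<noteq> 0" and qt: "\<And>i. i \<le> d \<Longrightarrow> poly (q i) t \<noteq> 0"
    by (auto simp: poly_prod)
  have inj: "inj_on (of_nat :: nat \<Rightarrow> 'a) {..d}" by (simp add: inj_on_def)
  obtain \<omega> where \<omega>: "\<forall>i\<in>{..d}. \<omega> i \<noteq> 0"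
    "\<forall>m<Suc d. (\<Sum>i\<le>d. \<omega> i * (\<Sum>n<Suc d. e i n * (F n / t ^ n)) * of_nat i ^ m) = F m / t ^ m"
    using moment_weights[OF finite_atMost inj, of "\<lambda>n. F n / t ^ n"] unfolding e_def card_atMost by blast
  let ?y = "\<lambda>i. \<omega> i * (\<Sum>n<Suc d. e i n * (F n / t ^ n))"
  have "?y i \<noteq> 0" if "i \<le> d" for i
  proof -
    have "t ^ d * (\<Sum>n<Suc d. e i n * (F n / t ^ n)) = poly (q i) t"
      unfolding q sum_distrib_left lessThan_Suc_atMost
    proof (rule sum.cong)
      fix n assume "n \<in> {..d}"
      then have "t ^ d = t ^ (d - n) * t ^ n" by (simp flip: power_add)
      then show "t ^ d * (e i n * (F n / t ^ n)) = e i n * F n * t ^ (d - n)" using t0 by simp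
    qed simp
    then show ?thesis using qt[OF that] \<omega>(1) that by auto
  qed
  moreover have "(\<Sum>i\<le>d. ?y i * (t * of_nat i) ^ m) = F m" if "m \<le> d" for m
  proof -
    have "(\<Sum>i\<le>d. ?y i * (t * of_nat i) ^ m) = t ^ m * (\<Sum>i\<le>d. ?y i * of_nat i ^ m)"
      unfolding sum_distrib_left[of "t ^ m"] power_mult_distrib by (intro sum.cong refl mult.left_commute)
    also have "\<dots> = F m" using \<omega>(2)[rule_format, of m] that t0 by simp
    finally show ?thesis .
  qed
  ultimately show ?thesis using t0 by (intro exI[of _ t] exI[of _ ?y]) blast
qed

section \<open>Linear forms and sums of their powers\<close>

abbreviation const :: "'k::zero \<Rightarrow> ('x, 'k) mpolynomial" where
  "const c \<equiv> Poly_Mapping.single 0 c"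

abbreviation var :: "'x \<Rightarrow> ('x, 'k::zero_neq_one) mpolynomial" where
  "var i \<equiv> Poly_Mapping.single (Poly_Mapping.single i 1) 1"

lemma const_mult: "const (a * b) = (const a * const b :: ('x, 'k::comm_semiring_1) mpolynomial)"
  by (simp add: mult_single)

lemma const_power: "const (a ^ n) = (const a ^ n :: ('x, 'k::comm_semiring_1) mpolynomial)"
  by (induction n) (simp_all add: const_mult)

lemma const_sum: "const (sum g I) = (\<Sum>i\<in>I. const (g i) :: ('x, 'k::comm_semiring_1) mpolynomial)"
  by (induction I rule: infinite_finite_induct) (simp_all add: single_add)

lemma forms_add: "u \<in> forms d \<Longrightarrow> v \<in> forms d \<Longrightarrow> u + v \<in> forms d"
  using keys_add[of u v] unfolding forms_def by blast

lemma forms_const_mult: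
  fixes v :: "('x, 'k::comm_semiring_1) mpolynomial"
  assumes "v \<in> forms d"
  shows "const c * v \<in> forms d"
proof -
  have "Poly_Mapping.keys (const c * v) \<subseteq> Poly_Mapping.keys v"
    using keys_mult[of "const c" v] by (auto split: if_splits)
  then show ?thesis using assms unfolding forms_def by blast
qed

lemma var_in_forms: "(var i :: ('x, 'k::comm_semiring_1) mpolynomial) \<in> forms 1"
  by (simp add: forms_def monomial_degree_def)

definition power_sums :: "nat \<Rightarrow> nat \<Rightarrow> ('x, 'k::comm_semiring_1) mpolynomial set" where
  "power_sums d r = {f. \<exists>v. (\<forall>i<r. v i \<in> forms 1) \<and> f = (\<Sum>i<r. v i ^ d)}"

lemma power_sums_add:
  assumes "f \<in> power_sums d r" "g \<in> power_sums d s"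
  shows "f + g \<in> power_sums d (r + s)"
proof -
  obtain u v where u: "\<forall>i<r. u i \<in> forms 1" "f = (\<Sum>i<r. u i ^ d)"
    and v: "\<forall>i<s. v i \<in> forms 1" "g = (\<Sum>i<s. v i ^ d)"
    using assms unfolding power_sums_def by blast
  define w where "w i = (if i < r then u i else v (i - r))" for i
  have "(\<Sum>i<r + n. w i ^ d) = (\<Sum>i<r. u i ^ d) + (\<Sum>i<n. v i ^ d)" for n
    by (induction n) (simp_all add: w_def add.assoc)
  then have "f + g = (\<Sum>i<r + s. w i ^ d)" by (simp add: u v)
  moreover have "\<forall>i<r + s. w i \<in> forms 1" using u(1) v(1) by (auto simp: w_def)
  ultimately show ?thesis unfolding power_sums_def by blast
qed

lemma power_sums_sum:
  fixes n :: nat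
  assumes "\<And>i. i \<le> n \<Longrightarrow> g i \<in> power_sums d (r i)"
  shows "(\<Sum>i\<le>n. g i) \<in> power_sums d (\<Sum>i\<le>n. r i)"
  using assms by (induction n) (simp_all add: power_sums_add)

lemma waring_rank_le:
  assumes "f \<in> power_sums d r"
  shows "waring_rank d f \<le> enat r"
  unfolding waring_rank_def using assms by (intro Inf_lower) (simp add: power_sums_def)

text \<open>Over an algebraically closed field each weight has a \<open>d\<close>-th root, which is
  absorbed into the linear form.\<close>

lemma weighted_power_sum:
  fixes v :: "nat \<Rightarrow> ('x, 'k::alg_closed_field) mpolynomial"
  assumes "d > 0" "\<And>s. s < r \<Longrightarrow> v s \<in> forms 1"
  shows "(\<Sum>s<r. const (c s) * v s ^ d) \<in> power_sums d r"
proof -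
  have "\<forall>s. \<exists>b. b ^ d = c s" using nth_root_exists[OF assms(1)] by blast
  then obtain b where b: "\<And>s. b s ^ d = c s" by metis
  have "(\<Sum>s<r. const (c s) * v s ^ d) = (\<Sum>s<r. (const (b s) * v s) ^ d)"
    by (simp add: power_mult_distrib flip: b const_power)
  moreover have "\<forall>s<r. const (b s) * v s \<in> forms 1" using forms_const_mult[OF assms(2)] by blast
  ultimately show ?thesis
    unfolding power_sums_def by (intro CollectI exI[of _ "\<lambda>s. const (b s) * v s"] conjI)
qed

section \<open>Expansions in three linear forms\<close>

text \<open>The outer index is the exponent of \<open>C\<close>, which is the order \<open>k\<close>
  of the moment equations.\<close>

definition expansion where
  "expansion A B C d G = (\<Sum>k\<le>d. \<Sum>m\<le>d - k. const (G k m) * C ^ k * B ^ m * A ^ (d - k - m))"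

lemma expansion_cong:
  assumes "\<And>k m. k + m \<le> d \<Longrightarrow> G k m = G' k m"
  shows "expansion A B C d G = expansion A B C d G'"
  unfolding expansion_def by (intro sum.cong refl) (simp add: assms)

lemma expansion_sum:
  fixes A :: "('x, 'k::comm_semiring_1) mpolynomial"
  shows "expansion A B C d (\<lambda>k m. \<Sum>i\<in>I. G i k m) = (\<Sum>i\<in>I. expansion A B C d (G i))"
proof -
  have "expansion A B C d (\<lambda>k m. \<Sum>i\<in>I. G i k m) =
      (\<Sum>k\<le>d. \<Sum>m\<le>d - k. \<Sum>i\<in>I. const (G i k m) * C ^ k * B ^ m * A ^ (d - k - m))"
    by (simp add: expansion_def const_sum sum_distrib_right)
  also have "\<dots> = (\<Sum>k\<le>d. \<Sum>i\<in>I. \<Sum>m\<le>d - k. const (G i k m) * C ^ k * B ^ m * A ^ (d - k - m))"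
    by (intro sum.cong refl sum.swap)
  also have "\<dots> = (\<Sum>i\<in>I. expansion A B C d (G i))"
    unfolding expansion_def by (rule sum.swap)
  finally show ?thesis .
qed

lemma expansion_monomial:
  fixes A :: "('x, 'k::comm_semiring_1) mpolynomial"
  assumes "a + b + c = d"
  shows "const z * A ^ a * B ^ b * C ^ c =
    expansion A B C d (\<lambda>k m. if k = c \<and> m = b then z else 0)"
proof -
  have "expansion A B C d (\<lambda>k m. if k = c \<and> m = b then z else 0) =
      (\<Sum>k\<le>d. \<Sum>m\<le>d - k. if m = b then if k = c then const z * A ^ a * B ^ b * C ^ c else 0 else 0)"
    unfolding expansion_def using assms by (intro sum.cong refl) (auto simp: mult_ac)
  also have "\<dots> = (\<Sum>k\<le>d. if k = c then const z * A ^ a * B ^ b * C ^ c else 0)"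
    using assms by (intro sum.cong refl) auto
  also have "\<dots> = const z * A ^ a * B ^ b * C ^ c" using assms by simp
  finally show ?thesis by simp
qed

lemma of_nat_eq_const: "(of_nat n :: ('x, 'k::comm_ring_1) mpolynomial) = const (of_nat n)"
  by simp

text \<open>By the trinomial theorem, a single power of a linear form yields the geometric sequence
  \<open>w ^ k\<close> at the node \<open>x\<close>.\<close>

lemma expansion_power:
  fixes A :: "('x, 'k::comm_ring_1) mpolynomial"
  shows "(A + const x * B + const w * C) ^ d =
    expansion A B C d (\<lambda>k m. of_nat (d choose k) * of_nat ((d - k) choose m) * x ^ m * w ^ k)"
proof -
  have "(A + const x * B + const w * C) ^ d = (const w * C + (const x * B + A)) ^ d"
    by (simp add: add_ac)
  also have "\<dots> = (\<Sum>k\<le>d. \<Sum>m\<le>d - k. of_nat (d choose k) * (const w * C) ^ k *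
      (of_nat ((d - k) choose m) * (const x * B) ^ m * A ^ (d - k - m)))"
    by (simp add: binomial_ring sum_distrib_left)
  also have "\<dots> = expansion A B C d (\<lambda>k m. of_nat (d choose k) * of_nat ((d - k) choose m) * x ^ m * w ^ k)"
    unfolding expansion_def
    by (intro sum.cong refl) (simp only: const_mult const_power of_nat_eq_const power_mult_distrib mult_ac)
  finally show ?thesis .
qed

section \<open>Ternary forms in adapted coordinates\<close>

lemma var_power: "var i ^ n = Poly_Mapping.single (Poly_Mapping.single i n) (1 :: 'k::comm_semiring_1)"
  by (induction n) (simp_all add: mult_single single_add[symmetric])

lemma poly_mapping_ternary:
  fixes m :: "'x \<Rightarrow>\<^sub>0 nat"
  assumes "UNIV = {a, b, c :: 'x}" "distinct [a, b, c]"
  shows "m = Poly_Mapping.single a (Poly_Mapping.lookup m a) +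
    Poly_Mapping.single b (Poly_Mapping.lookup m b) + Poly_Mapping.single c (Poly_Mapping.lookup m c)"
proof (rule poly_mapping_eqI)
  fix i
  have "i \<in> {a, b, c}" using assms(1) by blast
  then show "Poly_Mapping.lookup m i = Poly_Mapping.lookup (Poly_Mapping.single a (Poly_Mapping.lookup m a) +
    Poly_Mapping.single b (Poly_Mapping.lookup m b) + Poly_Mapping.single c (Poly_Mapping.lookup m c)) i"
    using assms(2) by (auto simp: lookup_add lookup_single when_def)
qed

lemma monomial_degree_ternary:
  assumes "UNIV = {a, b, c :: 'x}" "distinct [a, b, c]"
  shows "monomial_degree m = Poly_Mapping.lookup m a + Poly_Mapping.lookup m b + Poly_Mapping.lookup m c"
proof -
  have "finite (UNIV :: 'x set)" by (simp add: assms(1))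
  then have "monomial_degree m = (\<Sum>i\<in>UNIV. Poly_Mapping.lookup m i)"
    unfolding monomial_degree_def by (intro sum.mono_neutral_left) (auto simp: in_keys_iff)
  then show ?thesis using assms(2) by (simp add: assms(1) add.assoc)
qed

lemma sum_monomials: "f = (\<Sum>m\<in>Poly_Mapping.keys f. Poly_Mapping.single m (Poly_Mapping.lookup f m))"
proof (rule poly_mapping_eqI)
  fix i
  show "Poly_Mapping.lookup f i =
      Poly_Mapping.lookup (\<Sum>m\<in>Poly_Mapping.keys f. Poly_Mapping.single m (Poly_Mapping.lookup f m)) i"
    by (simp add: lookup_sum lookup_single when_def in_keys_iff)
qed

lemma ternary_monomial:
  fixes z :: "'k::comm_semiring_1"
  assumes "UNIV = {a, b, c :: 'x}" "distinct [a, b, c]"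
  shows "Poly_Mapping.single m z = const z * var a ^ Poly_Mapping.lookup m a *
    var b ^ Poly_Mapping.lookup m b * var c ^ Poly_Mapping.lookup m c"
  by (subst poly_mapping_ternary[OF assms, of m])
    (simp only: var_power mult_single add_0_left mult_1_right)

text \<open>Kronecker's substitution \<open>(\<tau>, 1, \<tau> ^ Suc d)\<close> separates the monomials of degree \<open>d\<close>.\<close>
lemma form_nonvanishing:
  fixes f :: "('x, 'k::field_char_0) mpolynomial"
  assumes abc: "UNIV = {a, b, c :: 'x}" "distinct [a, b, c]" and f: "f \<in> forms d" "f \<noteq> 0"
  shows "\<exists>s t. (\<Sum>m\<in>Poly_Mapping.keys f. Poly_Mapping.lookup f m *
    s ^ Poly_Mapping.lookup m a * t ^ Poly_Mapping.lookup m c) \<noteq> 0"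
proof -
  define N where "N m = Poly_Mapping.lookup m a + Suc d * Poly_Mapping.lookup m c" for m
  define P where "P = (\<Sum>m\<in>Poly_Mapping.keys f. monom (Poly_Mapping.lookup f m) (N m))"
  have deg: "Poly_Mapping.lookup m a + Poly_Mapping.lookup m b + Poly_Mapping.lookup m c = d"
    if "m \<in> Poly_Mapping.keys f" for m
    using f(1) that monomial_degree_ternary[OF abc, of m] unfolding forms_def by simp
  have inj: "m = m'" if m: "m \<in> Poly_Mapping.keys f" "m' \<in> Poly_Mapping.keys f" and N: "N m = N m'" for m m'
  proof -
    have lt: "Poly_Mapping.lookup m a < Suc d" "Poly_Mapping.lookup m' a < Suc d"
      using deg[OF m(1)] deg[OF m(2)] by simp_all
    have "N m mod Suc d = N m' mod Suc d" "N m div Suc d = N m' div Suc d" using N by simp_all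
    then have "Poly_Mapping.lookup m a = Poly_Mapping.lookup m' a"
      "Poly_Mapping.lookup m c = Poly_Mapping.lookup m' c"
      using lt unfolding N_def by (simp_all only: mod_mult_self2 div_mult_self2 mod_less div_less)
    moreover from this have "Poly_Mapping.lookup m b = Poly_Mapping.lookup m' b"
      using deg[OF m(1)] deg[OF m(2)] by simp
    ultimately show ?thesis
      using poly_mapping_ternary[OF abc, of m] poly_mapping_ternary[OF abc, of m'] by simp
  qed
  obtain m0 where m0: "m0 \<in> Poly_Mapping.keys f" using f(2) by (metis ex_in_conv keys_eq_empty)
  have "coeff P (N m0) = (\<Sum>m\<in>Poly_Mapping.keys f. if m = m0 then Poly_Mapping.lookup f m else 0)"
    unfolding P_def coeff_sum coeff_monom using inj m0 by (intro sum.cong refl) auto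
  then have "coeff P (N m0) \<noteq> 0" using m0 by (simp add: in_keys_iff)
  then have "P \<noteq> 0" by auto
  then obtain \<tau> where "poly P \<tau> \<noteq> 0" using poly_all_0_iff_0 by blast
  moreover have "poly P \<tau> = (\<Sum>m\<in>Poly_Mapping.keys f. Poly_Mapping.lookup f m *
      \<tau> ^ Poly_Mapping.lookup m a * (\<tau> ^ Suc d) ^ Poly_Mapping.lookup m c)"
    unfolding P_def poly_sum poly_monom N_def by (simp only: power_add power_mult mult.assoc)
  ultimately show ?thesis by (intro exI[of _ \<tau>] exI[of _ "\<tau> ^ Suc d"]) simp
qed

text \<open>Setting \<open>A = C = 0\<close> and \<open>B = 1\<close> shows that the coefficient of
  \<open>B ^ d\<close> is the value of the original monomial at \<open>(s, 1, t)\<close>.\<close>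

lemma expansion_shifted_monomial:
  fixes A :: "('x, 'k::comm_ring_1) mpolynomial"
  assumes "i + j + l = d"
  shows "\<exists>G. G 0 d = z * s ^ i * t ^ l \<and>
    const z * (A + const s * B) ^ i * B ^ j * (C + const t * B) ^ l = expansion A B C d G"
proof -
  define g where "g u v = z * (of_nat (i choose u) * s ^ (i - u)) * (of_nat (l choose v) * t ^ (l - v))" for u v
  define M where "M u v = (\<lambda>k m. if k = v \<and> m = d - u - v then g u v else 0)" for u v
  define G where "G k m = (\<Sum>u\<le>i. \<Sum>v\<le>l. M u v k m)" for k m
  have "const z * (A + const s * B) ^ i * B ^ j * (C + const t * B) ^ l =
      const z * (\<Sum>u\<le>i. of_nat (i choose u) * A ^ u * (const s * B) ^ (i - u)) * B ^ j *
      (\<Sum>v\<le>l. of_nat (l choose v) * C ^ v * (const t * B) ^ (l - v))"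
    by (simp only: binomial_ring)
  also have "\<dots> = (\<Sum>u\<le>i. \<Sum>v\<le>l. const z * (of_nat (i choose u) * A ^ u * (const s * B) ^ (i - u)) * B ^ j *
      (of_nat (l choose v) * C ^ v * (const t * B) ^ (l - v)))"
    by (simp only: sum_distrib_left sum_distrib_right) (rule sum.swap)
  also have "\<dots> = (\<Sum>u\<le>i. \<Sum>v\<le>l. const (g u v) * A ^ u * B ^ (d - u - v) * C ^ v)"
  proof (intro sum.cong refl)
    fix u v assume "u \<in> {..i}" "v \<in> {..l}"
    then have "d - u - v = (i - u) + j + (l - v)" using assms by simp
    then show "const z * (of_nat (i choose u) * A ^ u * (const s * B) ^ (i - u)) * B ^ j *
        (of_nat (l choose v) * C ^ v * (const t * B) ^ (l - v)) = const (g u v) * A ^ u * B ^ (d - u - v) * C ^ v"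
      by (simp only: g_def const_mult const_power of_nat_eq_const power_mult_distrib power_add mult_ac)
  qed
  also have "\<dots> = (\<Sum>u\<le>i. \<Sum>v\<le>l. expansion A B C d (M u v))"
    unfolding M_def using assms by (intro sum.cong refl expansion_monomial) auto
  also have "\<dots> = expansion A B C d G"
    unfolding G_def[abs_def] by (simp only: expansion_sum)
  finally have *: "const z * (A + const s * B) ^ i * B ^ j * (C + const t * B) ^ l = expansion A B C d G" .
  have "G 0 d = (\<Sum>u\<le>i. \<Sum>v\<le>l. if v = 0 then if u = 0 then g 0 0 else 0 else 0)"
    unfolding G_def M_def using assms by (intro sum.cong refl) auto
  also have "\<dots> = (\<Sum>u\<le>i. if u = 0 then g 0 0 else 0)" by (intro sum.cong refl) simp
  also have "\<dots> = g 0 0" by simp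
  finally have "G 0 d = z * s ^ i * t ^ l" by (simp add: g_def)
  with * show ?thesis by blast
qed

text \<open>A non-zero form is non-zero at some point \<open>(s, 1, t)\<close>. Shearing the
  coordinates along \<open>var b\<close> turns its value there into the coefficient of
  \<open>B ^ d\<close>.\<close>

lemma ternary_expansion:
  fixes f :: "('x, 'k::field_char_0) mpolynomial"
  assumes "CARD('x) = 3" "f \<in> forms d" "f \<noteq> 0"
  shows "\<exists>A B C G. A \<in> forms 1 \<and> B \<in> forms 1 \<and> C \<in> forms 1 \<and> G 0 d \<noteq> 0 \<and> f = expansion A B C d G"
proof -
  obtain a b c :: 'x where abc: "UNIV = {a, b, c}" "distinct [a, b, c]"
    using assms(1) unfolding card_3_iff by auto
  obtain s t where st: "(\<Sum>m\<in>Poly_Mapping.keys f. Poly_Mapping.lookup f m *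
      s ^ Poly_Mapping.lookup m a * t ^ Poly_Mapping.lookup m c) \<noteq> 0"
    using form_nonvanishing[OF abc assms(2,3)] by blast
  define A :: "('x, 'k) mpolynomial" where "A = var a + const (- s) * var b"
  define C :: "('x, 'k) mpolynomial" where "C = var c + const (- t) * var b"
  have forms: "A \<in> forms 1" "(var b :: ('x, 'k) mpolynomial) \<in> forms 1" "C \<in> forms 1"
    unfolding A_def C_def by (intro forms_add forms_const_mult var_in_forms)+
  have AC: "var a = A + const s * var b" "var c = C + const t * var b"
    by (simp_all add: A_def C_def single_uminus)
  have "\<forall>m. \<exists>G. m \<in> Poly_Mapping.keys f \<longrightarrow>
      G 0 d = Poly_Mapping.lookup f m * s ^ Poly_Mapping.lookup m a * t ^ Poly_Mapping.lookup m c \<and>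
      Poly_Mapping.single m (Poly_Mapping.lookup f m) = expansion A (var b) C d G"
  proof
    fix m
    show "\<exists>G. m \<in> Poly_Mapping.keys f \<longrightarrow>
      G 0 d = Poly_Mapping.lookup f m * s ^ Poly_Mapping.lookup m a * t ^ Poly_Mapping.lookup m c \<and>
      Poly_Mapping.single m (Poly_Mapping.lookup f m) = expansion A (var b) C d G"
    proof (cases "m \<in> Poly_Mapping.keys f")
      case True
      then have "Poly_Mapping.lookup m a + Poly_Mapping.lookup m b + Poly_Mapping.lookup m c = d"
        using assms(2) monomial_degree_ternary[OF abc, of m] unfolding forms_def by simp
      from expansion_shifted_monomial[OF this, of "Poly_Mapping.lookup f m" s t A "var b" C]
      show ?thesis unfolding ternary_monomial[OF abc, of m] AC by blast
    qed blast
  qed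
  from choice[OF this] obtain G where G: "\<forall>m. m \<in> Poly_Mapping.keys f \<longrightarrow>
      G m 0 d = Poly_Mapping.lookup f m * s ^ Poly_Mapping.lookup m a * t ^ Poly_Mapping.lookup m c \<and>
      Poly_Mapping.single m (Poly_Mapping.lookup f m) = expansion A (var b) C d (G m)"
    by (elim exE)
  have "f = (\<Sum>m\<in>Poly_Mapping.keys f. expansion A (var b) C d (G m))"
    using G by (subst sum_monomials[of f]) (intro sum.cong refl, blast)
  also have "\<dots> = expansion A (var b) C d (\<lambda>k n. \<Sum>m\<in>Poly_Mapping.keys f. G m k n)"
    by (rule expansion_sum[symmetric])
  finally have "f = expansion A (var b) C d (\<lambda>k n. \<Sum>m\<in>Poly_Mapping.keys f. G m k n)" .
  moreover have "(\<Sum>m\<in>Poly_Mapping.keys f. G m 0 d) \<noteq> 0"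
    using st G by simp
  ultimately show ?thesis
    using forms by (intro exI[of _ A] exI[of _ "var b"] exI[of _ C]
      exI[of _ "\<lambda>k n. \<Sum>m\<in>Poly_Mapping.keys f. G m k n"] conjI)
qed

section \<open>Assembly of the decomposition\<close>

text \<open>Order \<open>k = d\<close> leaves only \<open>m = 0\<close>, so a discrepancy there is a
  multiple of \<open>C ^ d\<close>.\<close>

lemma expansion_top:
  fixes A :: "('x, 'k::comm_ring_1) mpolynomial"
  assumes "\<And>k m. \<lbrakk>k + m \<le> d; k < d\<rbrakk> \<Longrightarrow> G k m = H k m"
  shows "expansion A B C d G = expansion A B C d H + const (G d 0 - H d 0) * C ^ d"
proof -
  have "expansion A B C d G = (\<Sum>k<d. \<Sum>m\<le>d - k. const (G k m) * C ^ k * B ^ m * A ^ (d - k - m))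
      + const (G d 0) * C ^ d" for G :: "nat \<Rightarrow> nat \<Rightarrow> 'k"
    unfolding expansion_def by (simp flip: lessThan_Suc_atMost)
  moreover have "(\<Sum>k<d. \<Sum>m\<le>d - k. const (G k m) * C ^ k * B ^ m * A ^ (d - k - m)) =
      (\<Sum>k<d. \<Sum>m\<le>d - k. const (H k m) * C ^ k * B ^ m * A ^ (d - k - m))"
    using assms by (intro sum.cong refl) simp
  ultimately show ?thesis by (simp add: single_diff algebra_simps)
qed

text \<open>Expansions are linear in their coefficients, so each geometric sequence in
  \<open>z\<close> costs one power of \<open>A + x B + w C\<close>.\<close>

lemma expansion_power_sums:
  fixes A :: "('x, 'k::{alg_closed_field, field_char_0}) mpolynomial"
  assumes forms: "A \<in> forms 1" "B \<in> forms 1" "C \<in> forms 1" and "d > 0"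
    and z: "power_sum_seq r z"
  shows "expansion A B C d (\<lambda>k m. of_nat (d choose k) * of_nat ((d - k) choose m) * x ^ m * z k)
    \<in> power_sums d r"
proof -
  obtain c w where cw: "\<And>k. z k = (\<Sum>s<r. c s * w s ^ k)" using z unfolding power_sum_seq_def by blast
  have "expansion A B C d (\<lambda>k m. of_nat (d choose k) * of_nat ((d - k) choose m) * x ^ m * z k) =
      expansion A B C d (\<lambda>k m. \<Sum>s<r. c s * (of_nat (d choose k) * of_nat ((d - k) choose m) * x ^ m * w s ^ k))"
    by (intro expansion_cong) (simp add: cw sum_distrib_left mult_ac)
  also have "\<dots> = (\<Sum>s<r. expansion A B C d
      (\<lambda>k m. c s * (of_nat (d choose k) * of_nat ((d - k) choose m) * x ^ m * w s ^ k)))"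
    by (rule expansion_sum)
  also have "\<dots> = (\<Sum>s<r. const (c s) * (A + const x * B + const (w s) * C) ^ d)"
    unfolding expansion_power expansion_def const_mult[of "c _"]
    by (simp only: sum_distrib_left mult.assoc)
  finally show ?thesis
    using weighted_power_sum[OF \<open>d > 0\<close>, of r "\<lambda>s. A + const x * B + const (w s) * C" c]
      forms by (simp add: forms_add forms_const_mult)
qed

theorem proposition3p3:
  fixes f :: "('x, 'k::{alg_closed_field, field_char_0}) mpolynomial"
    and d :: nat
  assumes "CARD('x) = 3"
    and "d > 0"
    and "f \<in> forms d"
  shows "waring_rank d f \<le> enat (nat \<lfloor>real (d\<^sup>2 + 6 * d + 1) / 4\<rfloor>)"
proof (cases "f = 0")
  case True
  then have "f \<in> power_sums d 0" by (simp add: power_sums_def)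
  from waring_rank_le[OF this] show ?thesis by (rule order_trans) simp
next
  case False
  obtain A B C G where forms: "A \<in> forms 1" "B \<in> forms 1" "C \<in> forms 1"
    and G: "G 0 d \<noteq> 0" and f: "f = expansion A B C d G"
    using ternary_expansion[OF assms(1,3) False] by blast
  \<comment> \<open>The multinomial coefficient is non-zero for \<open>k + m \<le> d\<close>;
    elsewhere the division by zero yields 0.\<close>
  define F where "F k m = G k m / (of_nat (d choose k) * of_nat ((d - k) choose m))" for k m
  have "F 0 d \<noteq> 0" using G by (simp add: F_def)
  from initial_moments[of "F 0", OF this] obtain t y0 where t: "t \<noteq> 0" and y0: "\<forall>i\<le>d. y0 i \<noteq> 0"
    "\<forall>m\<le>d. (\<Sum>i\<le>d. y0 i * (t * of_nat i) ^ m) = F 0 m" by blast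
  define x where "x i = t * of_nat i" for i
  have inj: "inj_on x {..d}" using t by (simp add: inj_on_def x_def)
  \<comment> \<open>Orders up to \<open>2 * p + 1\<close> are all orders when \<open>d\<close> is
    odd, and all but \<open>k = d\<close> when \<open>d\<close> is even.\<close>
  define p where "p = (d - 1) div 2"
  have d: "d = 2 * p + 1 \<or> d = 2 * p + 2" unfolding p_def using assms(2) by presburger
  define r where "r i = (if i < 2 * p then Suc ((i + 1) div 2) else Suc p)" for i
  have "solves_moments d x F 0 y0" using y0(2) by (simp add: solves_moments_def x_def)
  from moments_by_power_sums[OF inj this, of p] y0(1) d
  obtain y where y: "\<forall>k\<le>2 * p + 1. solves_moments d x F k (y k)"
    "\<forall>i\<le>d. power_sum_seq (r i) (\<lambda>k. y k i)"
    unfolding r_def by auto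
  define g where "g i = expansion A B C d
    (\<lambda>k m. of_nat (d choose k) * of_nat ((d - k) choose m) * x i ^ m * y k i)" for i
  define H where "H k m = (\<Sum>i\<le>d. of_nat (d choose k) * of_nat ((d - k) choose m) * x i ^ m * y k i)" for k m
  have "(\<Sum>i\<le>d. g i) = expansion A B C d H"
    unfolding g_def H_def[abs_def] by (rule expansion_sum[symmetric])
  moreover have sum: "(\<Sum>i\<le>d. g i) \<in> power_sums d (\<Sum>i\<le>d. r i)"
    unfolding g_def using y(2) by (intro power_sums_sum expansion_power_sums forms assms(2)) simp
  moreover have H: "G k m = H k m" if "k + m \<le> d" "k \<le> 2 * p + 1" for k m
  proof -
    have "H k m = of_nat (d choose k) * of_nat ((d - k) choose m) * (\<Sum>i\<le>d. y k i * x i ^ m)"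
      by (simp add: H_def sum_distrib_left mult_ac)
    also have "\<dots> = of_nat (d choose k) * of_nat ((d - k) choose m) * F k m"
      using y(1) that unfolding solves_moments_def by simp
    also have "\<dots> = G k m" using that by (simp add: F_def)
    finally show ?thesis by simp
  qed
  ultimately have f_sum: "f = (\<Sum>i\<le>d. g i) + const (G d 0 - H d 0) * C ^ d"
    using expansion_top[of d G H A B C] d unfolding f by force
  have top: "const (G d 0 - H d 0) * C ^ d \<in> power_sums d 1"
    using weighted_power_sum[OF assms(2), of 1 "\<lambda>_. C" "\<lambda>_. G d 0 - H d 0"] forms by simp
  have bound: "nat \<lfloor>real (d\<^sup>2 + 6 * d + 1) / 4\<rfloor> = (d\<^sup>2 + 6 * d + 1) div 4"
    using floor_divide_of_nat_eq[where ?'a = real, of "d\<^sup>2 + 6 * d + 1" 4]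
    by (simp only: of_nat_numeral nat_int)
  show ?thesis
  proof (cases "d = 2 * p + 1")
    case True
    have "f = (\<Sum>i\<le>d. g i)" using f_sum H[of d 0] True by simp
    moreover have "(\<Sum>i\<le>d. r i) = p\<^sup>2 + 4 * p + 2"
      unfolding r_def True by (rule node_count)
    ultimately have "f \<in> power_sums d (p\<^sup>2 + 4 * p + 2)" using sum by (simp only:)
    moreover have "(d\<^sup>2 + 6 * d + 1) div 4 = p\<^sup>2 + 4 * p + 2"
      unfolding True by (simp add: power2_eq_square algebra_simps)
    ultimately show ?thesis unfolding bound using waring_rank_le by metis
  next
    case False
    then have d2: "d = Suc (2 * p + 1)" using d by simp
    have "r (Suc (2 * p + 1)) = Suc p" by (simp add: r_def)
    moreover have "(\<Sum>i\<le>2 * p + 1. r i) = p\<^sup>2 + 4 * p + 2"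
      unfolding r_def by (rule node_count)
    \<comment> \<open>Compared with the odd case there is one more node, with \<open>p + 1\<close>
      terms, and the extra multiple of \<open>C ^ d\<close>.\<close>
    ultimately have "(\<Sum>i\<le>d. r i) + 1 = p\<^sup>2 + 5 * p + 4"
      unfolding d2 sum.atMost_Suc by simp
    then have "f \<in> power_sums d (p\<^sup>2 + 5 * p + 4)"
      using power_sums_add[OF sum top] f_sum by (simp only:)
    moreover have "(d\<^sup>2 + 6 * d + 1) div 4 = p\<^sup>2 + 5 * p + 4"
      unfolding d2 by (simp add: power2_eq_square algebra_simps)
    ultimately show ?thesis unfolding bound using waring_rank_le by metis
  qed
qed

end
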